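(* For $x$ a positive real number, each of the following asymptotic relations holds as $x\to\infty$: (i) $\Gamma(x+1)\sim \sqrt{2\pi}\left(\dfrac{x+1/2}{e}\right)^{x+1/2}$; (ii) $\Gamma(x+1)\sim \sqrt{\pi}\left(\dfrac{x}{e}\right)^x\sqrt{2x+\dfrac{1}{3}}$; (iii) $\Gamma(x+1)\sim \sqrt{2\pi x}\left(\dfrac{x}{e}+\dfrac{1}{12\,e\,x}\right)^x$; (iv) $\Gamma(x+1)\sim \sqrt{\pi}\left(\dfrac{x}{e}\right)^x\left(8x^3+4x^2+x+\dfrac{1}{30}\right)^{\frac{1}{6}}$; (v) for each fixed $n\in\mathbb{N}$ and for $a_i,b_i\in\mathbb{N}$ ($3\le i\le n$), $$\Gamma(x+1)\sim e^{-x}x^{x+\frac{1}{2}}\sqrt{2\pi}\left(1+\frac{1}{12x}+\frac{1}{288x^2}+\sum_{i=3}^n\frac{a_i}{b_i x^i}\right);$$ (vi) $\Gamma(x+1)\sim \sqrt{2\pi x}\left(\dfrac{x}{e}\right)^x\left(1+\dfrac{1}{12x^2-\frac{1}{10}}\right)^x$; (vii) $\Gamma(x+1)\sim \sqrt{2\pi x}\left(\dfrac{x}{e}\right)^x\left(x\sinh\left(\dfrac{1}{x}\right)\right)^{\frac{x}{2}}$; (viii) $\Gamma(x+1)\sim \sqrt{\pi}\left(\dfrac{x}{e}\right)^x\left(8x^3+4x^2+x+\dfrac{1-\frac{11}{8x}+\frac{79}{112x^2}}{30}\right)^{\frac{1}{6}}$; (ix) $\Gamma(x+1)\sim \sqrt{2\pi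 x}\left(\dfrac{x}{e}\right)^x\left(1+\dfrac{1}{12x^3+\frac{24}{7}x-\frac{1}{2}}\right)^{x^2+\frac{53}{210}}$.
   Context: Here $\Gamma$ is the Euler gamma function, and $x$ is a real variable. The notation $g(x)\sim h(x)$ (as $x\to\infty$) means that $g$ is asymptotic to $h$, i.e. $\lim_{x\to\infty} g(x)/h(x)=1$; the expressions on the right-hand sides need only be defined for all sufficiently large $x$. $\mathbb{N}$ denotes the set of positive integers, and a sum $\sum_{i=3}^n$ with $n<3$ is empty (equal to $0$). *)

theory Defs
  imports "HOL-Analysis.Analysis" "HOL-Library.Landau_Symbols"
begin

end

theory Submission
  imports Defs "HOL-Real_Asymp.Real_Asymp"
begin

text \<open>
  All nine relations are Stirling's formula
  \<open>Gamma (x + 1) \<sim> sqrt (2 * pi * x) * (x / exp 1) powr x\<close> in disguise: each right-hand side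
  is the Stirling term times an elementary factor that tends to \<open>1\<close>
  (\<open>Gamma_real_stirling_correction\<close>). The approximations differ in how fast
  this factor converges.

  For Stirling's formula on the real line, let \<open>\<mu>\<close> (\<open>stirling_remainder\<close>) be the error in
  \<open>ln_Gamma x \<approx> (x - 1/2) * ln x - x\<close>. The recurrence of the Gamma function turns
  \<open>\<mu> x - \<mu> (x + 1)\<close> into \<open>(x + 1/2) * ln (1 + 1 / x) - 1\<close>, and here
  \<open>ln (1 + 1 / x)\<close> is the integral of the convex function \<open>1 / t\<close> over \<open>[x, x + 1]\<close>. Bounding it
  below by the midpoint rule and above by the trapezoidal rule shows that \<open>\<mu>\<close> decreases
  along the positive integers while \<open>\<mu> x - 1 / (4 * x)\<close> increases, so \<open>\<mu>\<close> converges along them. The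
  convergence extends to real arguments because \<open>ln x - 1 / x \<le> Digamma x \<le> ln x\<close> makes the
  derivative of \<open>\<mu>\<close> at most \<open>1 / (2 * x)\<close> in absolute value. Finally, the limit \<open>c\<close> is
  identified by Legendre's duplication formula: it expresses
  \<open>\<mu> x + \<mu> (x + 1/2) - \<mu> (2 * x)\<close>, whose limit is \<open>c + c - c\<close>, by elementary functions
  with limit \<open>ln (2 * pi) / 2\<close>.
\<close>

section \<open>The remainder in Stirling's formula\<close>

definition stirling_remainder :: "real \<Rightarrow> real" where
  "stirling_remainder x = ln_Gamma x - ((x - 1/2) * ln x - x)"

lemma ln_Gamma_real_plus1:
  assumes "x > (0::real)"
  shows "ln_Gamma (x + 1) = ln_Gamma x + ln x"
proof -
  have "x \<notin> \<int>\<^sub>\<le>\<^sub>0"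
    using assms by (auto elim!: nonpos_Ints_cases)
  then have "Gamma (x + 1) = x * Gamma x"
    by (rule Gamma_plus1)
  then show ?thesis
    using assms Gamma_real_pos[OF assms] by (simp add: ln_Gamma_real_pos ln_mult_pos)
qed

text \<open>
  By the mean value theorem, \<open>ln x = ln_Gamma (x + 1) - ln_Gamma x\<close> is a value of \<open>Digamma\<close>
  between \<open>x\<close> and \<open>x + 1\<close>, and \<open>Digamma\<close> is monotone with
  \<open>Digamma (x + 1) = Digamma x + 1 / x\<close>.
\<close>

lemma Digamma_real_bounds:
  assumes "x > (0::real)"
  shows "ln x - 1 / x \<le> Digamma x" "Digamma x \<le> ln x"
proof -
  have "\<exists>z>x. z < x + 1 \<and> ln_Gamma (x + 1) - ln_Gamma x = (x + 1 - x) * Digamma z"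
    using assms by (intro MVT2) (auto intro!: derivative_eq_intros)
  then obtain z where z: "x < z" "z < x + 1" "ln x = Digamma z"
    using ln_Gamma_real_plus1[OF assms] by auto
  show "Digamma x \<le> ln x"
    using z assms Digamma_real_mono[of x z] by simp
  show "ln x - 1 / x \<le> Digamma x"
    using z assms Digamma_real_mono[of z "x + 1"] Digamma_plus1[of x] by simp
qed

text \<open>
  The derivative of the remainder is \<open>Digamma x - ln x + 1 / (2 * x)\<close>, and the bounds on
  \<open>Digamma\<close> are symmetric about \<open>ln x - 1 / (2 * x)\<close>. Hence the remainder varies by
  \<open>O(1 / x)\<close> between \<open>x\<close> and the integer below it.
\<close>

lemma stirling_remainder_lipschitz:
  assumes "0 < a" "a \<le> x"
  shows "\<bar>stirling_remainder x - stirling_remainder a\<bar> \<le> (x - a) / (2 * a)"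
proof (cases "x = a")
  case False
  with assms have "a < x" by simp
  have "\<exists>z>a. z < x \<and> stirling_remainder x - stirling_remainder a =
          (x - a) * (Digamma z - ln z + 1 / (2 * z))"
  proof (rule MVT2)
    fix t assume "a \<le> t" "t \<le> x"
    then have "t > 0" using assms by simp
    then show "(stirling_remainder has_real_derivative (Digamma t - ln t + 1 / (2 * t))) (at t)"
      unfolding stirling_remainder_def [abs_def]
      by (auto intro!: derivative_eq_intros simp: field_simps)
  qed fact
  then obtain z where z: "a < z" "z < x" 
    "stirling_remainder x - stirling_remainder a = (x - a) * (Digamma z - ln z + 1 / (2 * z))"
    by blast
  have "\<bar>Digamma z - ln z + 1 / (2 * z)\<bar> \<le> 1 / (2 * z)"
    using Digamma_real_bounds[of z] z assms by (auto simp: abs_le_iff)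
  also have "\<dots> \<le> 1 / (2 * a)"
    using z assms by (intro divide_left_mono) auto
  finally have "(x - a) * \<bar>Digamma z - ln z + 1 / (2 * z)\<bar> \<le> (x - a) * (1 / (2 * a))"
    using assms by (intro mult_left_mono) auto
  then show ?thesis
    using z assms by (simp add: abs_mult)
qed simp

text \<open>
  The two parts are the midpoint and the trapezoidal estimate for the integral of \<open>1 / t\<close> over
  \<open>[x, x + 1]\<close>; the trapezoidal error telescopes because
  \<open>(x + 1/2) * (1 / x + 1 / (x + 1)) / 2 - 1 = 1 / (4 * x) - 1 / (4 * (x + 1))\<close>.
\<close>

lemma stirling_remainder_step:
  assumes "x > 0"
  shows "stirling_remainder (x + 1) \<le> stirling_remainder x"
    and "stirling_remainder x - 1 / (4 * x) \<le> stirling_remainder (x + 1) - 1 / (4 * (x + 1))"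
proof -
  have diff: "stirling_remainder x - stirling_remainder (x + 1) = (x + 1/2) * (ln (x + 1) - ln x) - 1"
    using ln_Gamma_real_plus1[OF assms] by (simp add: stirling_remainder_def algebra_simps)
  have "1 = (x + 1/2) * (2 * (x + 1 - x) / (x + (x + 1)))"
    using assms by (simp add: field_simps)
  also have "\<dots> \<le> (x + 1/2) * (ln (x + 1) - ln x)"
    using assms by (intro mult_left_mono ln_inverse_approx_ge) auto
  finally show "stirling_remainder (x + 1) \<le> stirling_remainder x"
    using diff by simp
  have "(x + 1/2) * (ln (x + 1) - ln x) \<le> (x + 1/2) * (1 * (inverse x + inverse (x + 1)) / 2)"
    using assms by (intro mult_left_mono ln_inverse_approx_le) auto
  also have "\<dots> = 1 + (1 / (4 * x) - 1 / (4 * (x + 1)))"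
    using assms by (simp add: divide_simps) (simp add: algebra_simps)
  finally show "stirling_remainder x - 1 / (4 * x) \<le> stirling_remainder (x + 1) - 1 / (4 * (x + 1))"
    using diff by simp
qed

lemma stirling_remainder_converges:
  obtains c where "(stirling_remainder \<longlongrightarrow> c) at_top"
proof -
  (* The shift by one keeps the argument positive at n = 0. *)
  define X where "X n = stirling_remainder (real n + 1)" for n
  have "decseq X"
  proof (rule decseq_SucI)
    show "X (Suc n) \<le> X n" for n
      using stirling_remainder_step(1)[of "real n + 1"] by (simp add: X_def add_ac)
  qed
  moreover have "stirling_remainder 1 - 1/4 \<le> X n" for n
  proof -
    have "stirling_remainder 1 - 1/4 \<le> X n - 1 / (4 * (real n + 1))"
    proof (induction n)
      case (Suc n)
      then show ?case
        using stirling_remainder_step(2)[of "real n + 1"] by (simp add: X_def add_ac)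
    qed (simp add: X_def)
    also have "\<dots> \<le> X n" by simp
    finally show ?thesis .
  qed
  ultimately obtain c where "X \<longlonglongrightarrow> c"
    using decseq_convergent by blast
  moreover have "filterlim (\<lambda>x::real. nat \<lfloor>x - 1\<rfloor>) sequentially at_top"
    by real_asymp
  ultimately have lim: "((\<lambda>x::real. X (nat \<lfloor>x - 1\<rfloor>)) \<longlongrightarrow> c) at_top"
    by (rule filterlim_compose)
  have "((\<lambda>x. stirling_remainder x - X (nat \<lfloor>x - 1\<rfloor>)) \<longlongrightarrow> 0) at_top"
  proof (rule Lim_null_comparison)
    show "\<forall>\<^sub>F x in at_top. norm (stirling_remainder x - X (nat \<lfloor>x - 1\<rfloor>)) \<le> 1 / (2 * (x - 1))"
      using eventually_gt_at_top[of 1]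
    proof eventually_elim
      case (elim x)
      define a where "a = real (nat \<lfloor>x - 1\<rfloor>) + 1"
      have a: "x - 1 \<le> a" "a \<le> x" "0 < a"
        using elim unfolding a_def by linarith+
      have "\<bar>stirling_remainder x - stirling_remainder a\<bar> \<le> (x - a) / (2 * a)"
        using a by (intro stirling_remainder_lipschitz)
      also have "\<dots> \<le> 1 / (2 * (x - 1))"
        using a elim by (intro frac_le) auto
      finally show ?case by (simp add: X_def a_def)
    qed
    show "((\<lambda>x::real. 1 / (2 * (x - 1))) \<longlongrightarrow> 0) at_top"
      by real_asymp
  qed
  from tendsto_add[OF this lim] show ?thesis
    by (intro that[of c]) simp
qed

section \<open>Stirling's formula\<close>

lemma ln_Gamma_real_duplication:
  assumes "x > (0::real)"
  shows "ln_Gamma x + ln_Gamma (x + 1/2) = (1 - 2 * x) * ln 2 + ln pi / 2 + ln_Gamma (2 * x)"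
proof -
  have pos: "Gamma x > 0" "Gamma (x + 1/2) > 0" "Gamma (2 * x) > 0"
    using assms by (auto intro!: Gamma_real_pos)
  have notin: "complex_of_real y \<notin> \<int>\<^sub>\<le>\<^sub>0" if "y > 0" for y
    using that by (auto elim!: nonpos_Ints_cases simp: complex_eq_iff)
  have "complex_of_real (Gamma x * Gamma (x + 1/2)) =
        Gamma (complex_of_real x) * Gamma (complex_of_real x + 1/2)"
    by (simp flip: Gamma_complex_of_real)
  also have "\<dots> = exp ((1 - 2 * complex_of_real x) * of_real (ln 2)) * of_real (sqrt pi) *
                   Gamma (2 * complex_of_real x)"
    using assms notin[of x] notin[of "x + 1/2"] by (intro Gamma_legendre_duplication) auto
  also have "\<dots> = complex_of_real (exp ((1 - 2 * x) * ln 2) * sqrt pi * Gamma (2 * x))"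
    by (simp flip: Gamma_complex_of_real exp_of_real)
  finally have "Gamma x * Gamma (x + 1/2) = exp ((1 - 2 * x) * ln 2) * sqrt pi * Gamma (2 * x)"
    unfolding of_real_eq_iff .
  then have "ln (Gamma x * Gamma (x + 1/2)) = ln (exp ((1 - 2 * x) * ln 2) * sqrt pi * Gamma (2 * x))"
    by (rule arg_cong)
  then show ?thesis
    using assms pos by (simp add: ln_mult ln_Gamma_real_pos ln_sqrt)
qed

text \<open>
  In the duplication formula the limit \<open>c\<close> of the remainder occurs twice on the left and once on
  the right, so the formula leaves exactly one copy of it to be computed.
\<close>

lemma stirling_remainder_tendsto: "(stirling_remainder \<longlongrightarrow> ln (2 * pi) / 2) at_top"
proof -
  obtain c where c: "(stirling_remainder \<longlongrightarrow> c) at_top"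
    by (rule stirling_remainder_converges)
  have half: "((\<lambda>x. stirling_remainder (x + 1/2)) \<longlongrightarrow> c) at_top"
    by (rule filterlim_compose[OF c]) real_asymp
  have double: "((\<lambda>x. stirling_remainder (2 * x)) \<longlongrightarrow> c) at_top"
    by (rule filterlim_compose[OF c]) real_asymp
  have "((\<lambda>x. stirling_remainder x + stirling_remainder (x + 1/2) - stirling_remainder (2 * x))
          \<longlongrightarrow> c + c - c) at_top"
    by (intro tendsto_intros c half double)
  moreover have "((\<lambda>x. stirling_remainder x + stirling_remainder (x + 1/2) - stirling_remainder (2 * x))
          \<longlongrightarrow> ln (2 * pi) / 2) at_top"
  proof (rule Lim_transform_eventually)
    let ?f = "\<lambda>x::real. (1 - 2 * x) * ln 2 + ln pi / 2 + (2 * x - 1/2) * ln (2 * x)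
                - (x - 1/2) * ln x - x * ln (x + 1/2) + 1/2"
    have "(?f \<longlongrightarrow> ln 2 / 2 + ln pi / 2) at_top"
      by real_asymp
    then show "(?f \<longlongrightarrow> ln (2 * pi) / 2) at_top"
      by (simp add: ln_mult add_divide_distrib)
    show "\<forall>\<^sub>F x in at_top. ?f x =
            stirling_remainder x + stirling_remainder (x + 1/2) - stirling_remainder (2 * x)"
      using eventually_gt_at_top[of 0]
    proof eventually_elim
      case (elim x)
      then show ?case
        using ln_Gamma_real_duplication[of x]
        unfolding stirling_remainder_def by (simp add: algebra_simps)
    qed
  qed
  ultimately have "c + c - c = ln (2 * pi) / 2"
    by (intro tendsto_unique[of "at_top :: real filter"]) auto
  then have "c = ln (2 * pi) / 2"
    by simp
  with c show ?thesis
    by (simp only:)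
qed

theorem Gamma_real_stirling:
  "(\<lambda>x::real. Gamma (x + 1)) \<sim>[at_top] (\<lambda>x. sqrt (2 * pi * x) * (x / exp 1) powr x)"
proof (rule asymp_equivI')
  have "((\<lambda>x. exp (stirling_remainder x - ln (2 * pi) / 2)) \<longlongrightarrow> exp (ln (2 * pi) / 2 - ln (2 * pi) / 2)) at_top"
    by (intro tendsto_intros stirling_remainder_tendsto)
  then have "((\<lambda>x. exp (stirling_remainder x - ln (2 * pi) / 2)) \<longlongrightarrow> 1) at_top"
    by simp
  moreover have "\<forall>\<^sub>F x in at_top. exp (stirling_remainder x - ln (2 * pi) / 2) =
          Gamma (x + 1) / (sqrt (2 * pi * x) * (x / exp 1) powr x)"
    using eventually_gt_at_top[of 0]
  proof eventually_elim
    case (elim x)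
    have "ln (sqrt (2 * pi * x) * (x / exp 1) powr x) = ln (2 * pi) / 2 + ln x / 2 + (x * ln x - x)"
      using elim by (simp add: ln_mult ln_sqrt ln_powr ln_div algebra_simps)
    with ln_Gamma_real_plus1[OF elim] have "stirling_remainder x - ln (2 * pi) / 2 =
        ln_Gamma (x + 1) - ln (sqrt (2 * pi * x) * (x / exp 1) powr x)"
      unfolding stirling_remainder_def by (simp only:) (simp add: algebra_simps)
    then show ?case
      using elim by (simp add: exp_diff Gamma_real_pos_exp)
  qed
  ultimately show "((\<lambda>x. Gamma (x + 1) / (sqrt (2 * pi * x) * (x / exp 1) powr x)) \<longlongrightarrow> 1) at_top"
    by (rule Lim_transform_eventually)
qed

section \<open>Corrections of Stirling's formula\<close>

lemma inverse_power_sum_tendsto_1: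
  fixes a b :: "nat \<Rightarrow> nat"
  shows "((\<lambda>x::real. 1 + 1 / (12 * x) + 1 / (288 * x^2) +
           (\<Sum>i=3..n. real (a i) / (real (b i) * x^i))) \<longlongrightarrow> 1) at_top"
proof -
  have "((\<lambda>x::real. real (a i) / (real (b i) * x^i)) \<longlongrightarrow> 0) at_top" if "i \<in> {3..n}" for i
  proof -
    have "((\<lambda>x::real. inverse (x ^ i)) \<longlongrightarrow> 0) at_top"
      using that by (intro tendsto_inverse_0_at_top filterlim_pow_at_top filterlim_ident) auto
    from tendsto_mult_right_zero[OF this, of "real (a i) / real (b i)"] show ?thesis
      by (simp add: field_simps)
  qed
  then have "((\<lambda>x::real. \<Sum>i=3..n. real (a i) / (real (b i) * x^i)) \<longlongrightarrow> 0) at_top"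
    by (rule tendsto_null_sum)
  moreover have "((\<lambda>x::real. 1 + 1 / (12 * x) + 1 / (288 * x^2)) \<longlongrightarrow> 1) at_top"
    by real_asymp
  ultimately show ?thesis
    using tendsto_add by fastforce
qed

lemma Gamma_real_stirling_correction:
  assumes "(h \<longlongrightarrow> 1) at_top"
    and "\<And>x. x > 0 \<Longrightarrow> g x = sqrt (2 * pi * x) * (x / exp 1) powr x * h x"
  shows "(\<lambda>x::real. Gamma (x + 1)) \<sim>[at_top] g"
proof -
  have "h \<sim>[at_top] (\<lambda>_. 1)"
    using assms(1) by (intro tendsto_imp_asymp_equiv_const) auto
  with Gamma_real_stirling
  have "(\<lambda>x. Gamma (x + 1) * 1) \<sim>[at_top] (\<lambda>x. sqrt (2 * pi * x) * (x / exp 1) powr x * h x)"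
    by (intro asymp_equiv_mult) (simp_all add: asymp_equiv_sym)
  moreover have "\<forall>\<^sub>F x in at_top. sqrt (2 * pi * x) * (x / exp 1) powr x * h x = g x"
    using eventually_gt_at_top[of 0] by eventually_elim (simp add: assms(2))
  ultimately show ?thesis
    using asymp_equiv_refl_ev asymp_equiv_trans by fastforce
qed

text \<open>
  Shifting the base from \<open>x\<close> to \<open>x + 1/2\<close> multiplies the power by
  \<open>(1 + 1 / (2 * x)) powr (x + 1/2)\<close>, which tends to \<open>exp (1/2)\<close>; the additional \<open>1/2\<close> in the
  exponent of \<open>x / exp 1\<close> supplies \<open>sqrt x\<close> and the compensating \<open>exp (- 1/2)\<close>.
\<close>

lemma stirling_burnside_form:
  assumes "x > (0::real)"
  shows "sqrt (2 * pi) * ((x + 1/2) / exp 1) powr (x + 1/2) =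
         sqrt (2 * pi * x) * (x / exp 1) powr x * ((1 + 1 / (2 * x)) powr (x + 1/2) * exp (- 1/2))"
proof -
  have "(x + 1/2) / exp 1 = x / exp 1 * (1 + 1 / (2 * x))"
    using assms by (simp add: field_simps)
  then have "((x + 1/2) / exp 1) powr (x + 1/2) =
      (x / exp 1) powr (x + 1/2) * (1 + 1 / (2 * x)) powr (x + 1/2)"
    using assms by (simp only: powr_mult)
  also have "(x / exp 1) powr (x + 1/2) = (x / exp 1) powr x * (sqrt x * exp (- 1/2))"
  proof -
    have "(x / exp 1) powr (1/2) = sqrt x * exp (- 1/2)"
      using assms by (simp add: powr_divide powr_half_sqrt exp_powr_real exp_minus field_simps)
    then show ?thesis
      by (simp only: powr_add)
  qed
  finally show ?thesis
    by (simp add: real_sqrt_mult)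
qed

text \<open>
  The leading term \<open>8 * x ^ 3\<close> is the cube of \<open>2 * x\<close>, so its sixth root is the \<open>sqrt (2 * x)\<close>
  of the Stirling term, and the rest of the polynomial goes into \<open>q\<close>.
\<close>

lemma powr_sixth_form:
  assumes "x > (0::real)" "8 * x^3 + 4 * x^2 + x + d = (2 * x) ^ 3 * q"
  shows "sqrt pi * (x / exp 1) powr x * (8 * x^3 + 4 * x^2 + x + d) powr (1/6) =
         sqrt (2 * pi * x) * (x / exp 1) powr x * q powr (1/6)"
proof -
  have "((2 * x) ^ 3) powr (1/6) = ((2 * x) powr 3) powr (1/6)"
    using assms(1) by (subst powr_numeral) auto
  also have "\<dots> = (2 * x) powr (1/2)"
    by (simp only: powr_powr) simp
  also have "\<dots> = sqrt (2 * x)"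
    using assms(1) by (intro powr_half_sqrt) auto
  finally have "((2 * x) ^ 3) powr (1/6) = sqrt (2 * x)" .
  then show ?thesis
    unfolding assms(2) using assms(1) by (simp add: powr_mult real_sqrt_mult)
qed

theorem corollary2p2:
  shows
    "((\<lambda>x::real. Gamma (x + 1)) \<sim>[at_top]
        (\<lambda>x. sqrt (2 * pi) * ((x + 1/2) / exp 1) powr (x + 1/2)))
   \<and> ((\<lambda>x::real. Gamma (x + 1)) \<sim>[at_top]
        (\<lambda>x. sqrt pi * (x / exp 1) powr x * sqrt (2 * x + 1/3)))
   \<and> ((\<lambda>x::real. Gamma (x + 1)) \<sim>[at_top]
        (\<lambda>x. sqrt (2 * pi * x) * (x / exp 1 + 1 / (12 * exp 1 * x)) powr x))
   \<and> ((\<lambda>x::real. Gamma (x + 1)) \<sim>[at_top]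
        (\<lambda>x. sqrt pi * (x / exp 1) powr x * (8 * x^3 + 4 * x^2 + x + 1/30) powr (1/6)))
   \<and> (\<forall>(n::nat) (a::nat \<Rightarrow> nat) (b::nat \<Rightarrow> nat).
        n \<ge> 1 \<longrightarrow> (\<forall>i\<in>{3..n}. a i > 0 \<and> b i > 0) \<longrightarrow>
        (\<lambda>x::real. Gamma (x + 1)) \<sim>[at_top]
        (\<lambda>x. exp (- x) * x powr (x + 1/2) * sqrt (2 * pi) *
              (1 + 1 / (12 * x) + 1 / (288 * x^2) +
               (\<Sum>i=3..n. real (a i) / (real (b i) * x^i)))))
   \<and> ((\<lambda>x::real. Gamma (x + 1)) \<sim>[at_top]
        (\<lambda>x. sqrt (2 * pi * x) * (x / exp 1) powr x * (1 + 1 / (12 * x^2 - 1/10)) powr x))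
   \<and> ((\<lambda>x::real. Gamma (x + 1)) \<sim>[at_top]
        (\<lambda>x. sqrt (2 * pi * x) * (x / exp 1) powr x * (x * sinh (1 / x)) powr (x / 2)))
   \<and> ((\<lambda>x::real. Gamma (x + 1)) \<sim>[at_top]
        (\<lambda>x. sqrt pi * (x / exp 1) powr x *
              (8 * x^3 + 4 * x^2 + x + (1 - 11 / (8 * x) + 79 / (112 * x^2)) / 30) powr (1/6)))
   \<and> ((\<lambda>x::real. Gamma (x + 1)) \<sim>[at_top]
        (\<lambda>x. sqrt (2 * pi * x) * (x / exp 1) powr x *
              (1 + 1 / (12 * x^3 + 24/7 * x - 1/2)) powr (x^2 + 53/210)))"
proof (intro conjI allI impI)
  show "(\<lambda>x::real. Gamma (x + 1)) \<sim>[at_top]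
        (\<lambda>x. sqrt (2 * pi) * ((x + 1/2) / exp 1) powr (x + 1/2))"
  proof (rule Gamma_real_stirling_correction)
    have "((\<lambda>x::real. (1 + 1 / (2 * x)) powr (x + 1/2)) \<longlongrightarrow> exp (1/2)) at_top"
      by real_asymp
    from tendsto_mult_right[OF this, of "exp (- 1/2)"]
    show "((\<lambda>x::real. (1 + 1 / (2 * x)) powr (x + 1/2) * exp (- 1/2)) \<longlongrightarrow> 1) at_top"
      by (simp flip: exp_add)
  qed (rule stirling_burnside_form)
next
  show "(\<lambda>x::real. Gamma (x + 1)) \<sim>[at_top] (\<lambda>x. sqrt pi * (x / exp 1) powr x * sqrt (2 * x + 1/3))"
  proof (rule Gamma_real_stirling_correction)
    show "((\<lambda>x::real. sqrt (1 + 1 / (6 * x))) \<longlongrightarrow> 1) at_top"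
      by real_asymp
    fix x :: real
    assume "x > 0"
    then have "2 * x + 1/3 = 2 * x * (1 + 1 / (6 * x))"
      by (simp add: field_simps)
    then show "sqrt pi * (x / exp 1) powr x * sqrt (2 * x + 1/3) =
        sqrt (2 * pi * x) * (x / exp 1) powr x * sqrt (1 + 1 / (6 * x))"
      by (simp only: real_sqrt_mult mult_ac)
  qed
next
  show "(\<lambda>x::real. Gamma (x + 1)) \<sim>[at_top]
        (\<lambda>x. sqrt (2 * pi * x) * (x / exp 1 + 1 / (12 * exp 1 * x)) powr x)"
  proof (rule Gamma_real_stirling_correction)
    show "((\<lambda>x::real. (1 + 1 / (12 * x^2)) powr x) \<longlongrightarrow> 1) at_top"
      by real_asymp
    fix x :: real
    assume x: "x > 0"
    then have "x / exp 1 + 1 / (12 * exp 1 * x) = x / exp 1 * (1 + 1 / (12 * x^2))"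
      by (simp add: field_simps power2_eq_square)
    then show "sqrt (2 * pi * x) * (x / exp 1 + 1 / (12 * exp 1 * x)) powr x =
        sqrt (2 * pi * x) * (x / exp 1) powr x * (1 + 1 / (12 * x^2)) powr x"
      using x by (simp only: powr_mult mult.assoc)
  qed
next
  show "(\<lambda>x::real. Gamma (x + 1)) \<sim>[at_top]
        (\<lambda>x. sqrt pi * (x / exp 1) powr x * (8 * x^3 + 4 * x^2 + x + 1/30) powr (1/6))"
  proof (rule Gamma_real_stirling_correction)
    show "((\<lambda>x::real. (1 + 1 / (2 * x) + 1 / (8 * x^2) + 1 / (240 * x^3)) powr (1/6)) \<longlongrightarrow> 1) at_top"
      by real_asymp
  qed (rule powr_sixth_form, assumption, simp add: field_simps power2_eq_square power3_eq_cube)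
next
  fix n :: nat and a b :: "nat \<Rightarrow> nat"
  show "(\<lambda>x::real. Gamma (x + 1)) \<sim>[at_top]
        (\<lambda>x. exp (- x) * x powr (x + 1/2) * sqrt (2 * pi) *
              (1 + 1 / (12 * x) + 1 / (288 * x^2) +
               (\<Sum>i=3..n. real (a i) / (real (b i) * x^i))))"
  proof (rule Gamma_real_stirling_correction[OF inverse_power_sum_tendsto_1])
    fix x :: real
    assume x: "x > 0"
    have "x powr (x + 1/2) = x powr x * sqrt x"
      using x by (simp only: powr_add powr_half_sqrt[OF less_imp_le])
    moreover have "(x / exp 1) powr x = x powr x * exp (- x)"
      using x by (simp add: powr_divide exp_powr_real exp_minus field_simps)
    ultimately have "exp (- x) * x powr (x + 1/2) * sqrt (2 * pi) =
        sqrt (2 * pi * x) * (x / exp 1) powr x"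
      by (simp only: real_sqrt_mult mult_ac)
    then show "exp (- x) * x powr (x + 1/2) * sqrt (2 * pi) *
              (1 + 1 / (12 * x) + 1 / (288 * x^2) + (\<Sum>i=3..n. real (a i) / (real (b i) * x^i))) =
        sqrt (2 * pi * x) * (x / exp 1) powr x *
              (1 + 1 / (12 * x) + 1 / (288 * x^2) + (\<Sum>i=3..n. real (a i) / (real (b i) * x^i)))"
      by simp
  qed
next
  show "(\<lambda>x::real. Gamma (x + 1)) \<sim>[at_top]
        (\<lambda>x. sqrt (2 * pi * x) * (x / exp 1) powr x * (1 + 1 / (12 * x^2 - 1/10)) powr x)"
    by (rule Gamma_real_stirling_correction[OF _ refl]) real_asymp
next
  show "(\<lambda>x::real. Gamma (x + 1)) \<sim>[at_top]
        (\<lambda>x. sqrt (2 * pi * x) * (x / exp 1) powr x * (x * sinh (1 / x)) powr (x / 2))"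
    by (rule Gamma_real_stirling_correction[OF _ refl]) real_asymp
next
  show "(\<lambda>x::real. Gamma (x + 1)) \<sim>[at_top]
        (\<lambda>x. sqrt pi * (x / exp 1) powr x *
              (8 * x^3 + 4 * x^2 + x + (1 - 11 / (8 * x) + 79 / (112 * x^2)) / 30) powr (1/6))"
  proof (rule Gamma_real_stirling_correction)
    show "((\<lambda>x::real. (1 + 1 / (2 * x) + 1 / (8 * x^2) +
            (1 - 11 / (8 * x) + 79 / (112 * x^2)) / (240 * x^3)) powr (1/6)) \<longlongrightarrow> 1) at_top"
      by real_asymp
  qed (rule powr_sixth_form, assumption, simp add: field_simps power2_eq_square power3_eq_cube)
next
  show "(\<lambda>x::real. Gamma (x + 1)) \<sim>[at_top]
        (\<lambda>x. sqrt (2 * pi * x) * (x / exp 1) powr x *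
              (1 + 1 / (12 * x^3 + 24/7 * x - 1/2)) powr (x^2 + 53/210))"
    by (rule Gamma_real_stirling_correction[OF _ refl]) real_asymp
qed

end
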